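(* Let $n \ge 4$ be an integer. The only solution in positive real numbers $a_1, a_2, \dots, a_{2n}$ of the system of $2n$ equations $$a_{2i-1} = \frac{1}{a_{2i-2}} + \frac{1}{a_{2i}}, \qquad a_{2i} = a_{2i-1} + a_{2i+1} \qquad (i = 1, 2, \dots, n),$$ where indices are taken modulo $2n$ (so that $a_0 = a_{2n}$ and $a_{2n+1} = a_1$), is $$a_1 = a_3 = \cdots = a_{2n-1} = 1, \qquad a_2 = a_4 = \cdots = a_{2n} = 2.$$ *)

theory Defs
  imports Complex_Main
begin

end

theory Submission
  imports Defs
begin

text \<open>
  Eliminating the terms with odd index leaves, for \<open>y\<^sub>i = a\<^sub>2\<^sub>i\<close>, the cyclic system
  \<open>y\<^sub>i = 2/y\<^sub>i + 1/y\<^sub>i\<^sub>-\<^sub>1 + 1/y\<^sub>i\<^sub>+\<^sub>1\<close>. With \<open>m\<close> and \<open>M\<close> the minimum and maximum of the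
  \<open>y\<^sub>i\<close>, the equations at a maximal and at a minimal index give
  \<open>M \<le> 2/M + 2/m \<le> m\<close>, so \<open>y\<close> is constant with value \<open>2\<close>.
\<close>

text \<open>The argument compares each reciprocal only with those at the extremes, so the neighbours
  \<open>j\<close> and \<open>k\<close> may be arbitrary members of \<open>I\<close>. This form
  keeps the cyclic indexing out of the estimate.\<close>

lemma eq_2_if_eq_sum_of_reciprocals:
  fixes y :: "'a \<Rightarrow> real"
  assumes "finite I"
    and pos: "\<And>i. i \<in> I \<Longrightarrow> y i > 0"
    and eq: "\<And>i. i \<in> I \<Longrightarrow> \<exists>j\<in>I. \<exists>k\<in>I. y i = 2 / y i + 1 / y j + 1 / y k"
    and "i \<in> I"
  shows "y i = 2"
proof -
  have img: "finite (y ` I)" "y ` I \<noteq> {}"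
    using assms by auto
  obtain p where p: "p \<in> I" "y p = Min (y ` I)"
    using Min_in[OF img] by auto
  obtain q where q: "q \<in> I" "y q = Max (y ` I)"
    using Max_in[OF img] by auto
  have ge: "y p \<le> y j" and le: "y j \<le> y q" if "j \<in> I" for j
    using that p q \<open>finite I\<close> by simp_all
  have rec_le: "1 / y j \<le> 1 / y p" and rec_ge: "1 / y q \<le> 1 / y j" if "j \<in> I" for j
    using ge[OF that] le[OF that] pos[OF that] pos[OF p(1)] by (auto intro!: frac_le)
  have "y q \<le> 2 / y q + 2 / y p"
  proof -
    obtain j k where "j \<in> I" "k \<in> I" "y q = 2 / y q + 1 / y j + 1 / y k"
      using eq[OF q(1)] by blast
    with rec_le[of j] rec_le[of k] show ?thesis by linarith
  qed
  moreover have "2 / y p + 2 / y q \<le> y p"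
  proof -
    obtain j k where "j \<in> I" "k \<in> I" "y p = 2 / y p + 1 / y j + 1 / y k"
      using eq[OF p(1)] by blast
    with rec_ge[of j] rec_ge[of k] show ?thesis by linarith
  qed
  \<comment> \<open>The same quantity \<open>2 / y p + 2 / y q\<close> lies above the maximum and
    below the minimum.\<close>
  ultimately have "y q \<le> y p" by linarith
  then have const: "y j = y i" if "j \<in> I" for j
    using ge[OF that] le[OF that] ge[OF \<open>i \<in> I\<close>] le[OF \<open>i \<in> I\<close>] by linarith
  obtain j k where "j \<in> I" "k \<in> I" "y i = 2 / y i + 1 / y j + 1 / y k"
    using eq[OF \<open>i \<in> I\<close>] by blast
  moreover from this have "y j = y i" "y k = y i"
    using const by blast+
  ultimately have "y i = 2 / y i + 1 / y i + 1 / y i"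
    by metis
  \<comment> \<open>The common value \<open>c\<close> satisfies \<open>c = 4 / c\<close>; positivity
    then selects the root 2.\<close>
  then have "(y i)\<^sup>2 = 2\<^sup>2"
    using pos[OF \<open>i \<in> I\<close>] by (simp add: field_simps power2_eq_square)
  then show ?thesis
    by (rule power2_eq_imp_eq) (use pos[OF \<open>i \<in> I\<close>] in simp_all)
qed

theorem mainTheorem5:
  fixes n :: nat and a :: "nat \<Rightarrow> real"
  assumes "n \<ge> 4"
    and "a 0 = a (2 * n)"
    and "a (2 * n + 1) = a 1"
  shows "((\<forall>k\<in>{1..2 * n}. a k > 0) \<and>
          (\<forall>i\<in>{1..n}. a (2 * i - 1) = 1 / a (2 * i - 2) + 1 / a (2 * i) \<and>
                       a (2 * i) = a (2 * i - 1) + a (2 * i + 1)))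
         \<longleftrightarrow> (\<forall>i\<in>{1..n}. a (2 * i - 1) = 1 \<and> a (2 * i) = 2)"
    (is "?pos \<and> ?sys \<longleftrightarrow> ?sol")
proof
  assume L: "?pos \<and> ?sys"
  then have odd_eq: "a (2 * i - 1) = 1 / a (2 * i - 2) + 1 / a (2 * i)"
    and even_eq: "a (2 * i) = a (2 * i - 1) + a (2 * i + 1)" if "i \<in> {1..n}" for i
    using that by blast+
  \<comment> \<open>For \<open>i = 1\<close> the index is 0, and \<open>a 0 = a (2 * n)\<close>
    wraps it to \<open>j = n\<close>.\<close>
  have prev: "\<exists>j\<in>{1..n}. a (2 * i - 2) = a (2 * j)" if "i \<in> {1..n}" for i
  proof (cases "i = 1")
    case True
    then show ?thesis using assms by (intro bexI[of _ n]) auto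
  next
    case False
    with that show ?thesis by (intro bexI[of _ "i - 1"]) (auto simp: diff_mult_distrib2)
  qed
  \<comment> \<open>For \<open>i = n\<close> this is the first odd equation, read through both
    wrap-around identities.\<close>
  have succ: "\<exists>k\<in>{1..n}. a (2 * i + 1) = 1 / a (2 * i) + 1 / a (2 * k)" if "i \<in> {1..n}" for i
  proof (cases "i = n")
    case True
    then show ?thesis using assms odd_eq[of 1] by (intro bexI[of _ 1]) auto
  next
    case False
    with that show ?thesis using odd_eq[of "i + 1"] by (intro bexI[of _ "i + 1"]) auto
  qed
  have two: "a (2 * i) = 2" if "i \<in> {1..n}" for i
  proof (rule eq_2_if_eq_sum_of_reciprocals[of "{1..n}" "\<lambda>i. a (2 * i)"])
    show "a (2 * i) > 0" if "i \<in> {1..n}" for i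
      using conjunct1[OF L] that by auto
    show "\<exists>j\<in>{1..n}. \<exists>k\<in>{1..n}. a (2 * i) = 2 / a (2 * i) + 1 / a (2 * j) + 1 / a (2 * k)"
      if i: "i \<in> {1..n}" for i
    proof -
      obtain j where j: "j \<in> {1..n}" "a (2 * i - 2) = a (2 * j)"
        using prev[OF i] by blast
      obtain k where k: "k \<in> {1..n}" "a (2 * i + 1) = 1 / a (2 * i) + 1 / a (2 * k)"
        using succ[OF i] by blast
      \<comment> \<open>Both odd neighbours contribute \<open>1 / a (2 * i)\<close>, whence the
        numerator 2.\<close>
      have "a (2 * i) = 2 / a (2 * i) + 1 / a (2 * j) + 1 / a (2 * k)"
        using odd_eq[OF i, unfolded j(2)] even_eq[OF i] k(2) by linarith
      with j(1) k(1) show ?thesis by blast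
    qed
  qed (use that in auto)
  show ?sol
  proof
    fix i assume i: "i \<in> {1..n}"
    have "a (2 * i - 2) = 2"
      using prev[OF i] two by auto
    then show "a (2 * i - 1) = 1 \<and> a (2 * i) = 2"
      using odd_eq[OF i] two[OF i] by simp
  qed
next
  assume sol: ?sol
  then have odd_val: "a (2 * i - 1) = 1" and even_val: "a (2 * i) = 2" if "i \<in> {1..n}" for i
    using that by blast+
  have ?pos
  proof
    fix k assume k: "k \<in> {1..2 * n}"
    show "a k > 0"
    proof (cases "even k")
      case True
      then obtain i where "k = 2 * i" by blast
      with k even_val[of i] show ?thesis by auto
    next
      case False
      then obtain i where "k = 2 * i + 1" by (rule oddE)
      \<comment> \<open>Here \<open>k = 2 * (i + 1) - 1\<close>, so the odd value is taken at
        \<open>i + 1\<close>, which is at most \<open>n\<close>.\<close>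
      with k odd_val[of "i + 1"] show ?thesis by auto
    qed
  qed
  moreover have ?sys
  proof
    fix i assume i: "i \<in> {1..n}"
    have "a (2 * i - 2) = 2"
    proof (cases "i = 1")
      case True
      then show ?thesis using assms even_val[of n] by simp
    next
      case False
      with i have "i - 1 \<in> {1..n}" by auto
      from even_val[OF this] show ?thesis by (simp add: diff_mult_distrib2)
    qed
    \<comment> \<open>At \<open>i = n\<close> the index leaves the range and wraps to
      \<open>a 1\<close>.\<close>
    moreover have "a (2 * i + 1) = 1"
      using i assms odd_val[of 1] odd_val[of "i + 1"] by (cases "i = n") auto
    ultimately show "a (2 * i - 1) = 1 / a (2 * i - 2) + 1 / a (2 * i) \<and>
        a (2 * i) = a (2 * i - 1) + a (2 * i + 1)"
      using odd_val[OF i] even_val[OF i] by simp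
  qed
  ultimately show "?pos \<and> ?sys" ..
qed

end
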